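(* Let $E: y^2 = 4x^3 - g_2x - g_3$ be any elliptic curve with $g_2,g_3\in\mathbb{R}$, and let $\psi:\mathbb{N}\to\mathbb{R}_{>0}$ be any function. Then there exists a point $P\in E(\mathbb{R})$ such that for infinitely many positive integers $n$, $$x(nP) > \psi(n)^2 \quad\text{and}\quad y(nP) > \psi(n)^3.$$
   Context: $E(\mathbb{R})$ is the group of real points of $E$ (with the point at infinity); $x(Q),y(Q)$ are the coordinates of a point $Q$. *)

theory Defs
  imports Complex_Main "HOL-Algebra.Group"
begin

definition elliptic_curve :: "real \<Rightarrow> real \<Rightarrow> bool" where
  "elliptic_curve g2 g3 \<longleftrightarrow> g2 ^ 3 - 27 * g3 ^ 2 \<noteq> 0"

text \<open>Nonvanishing of the discriminant is smoothness of the affine curve over the complex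
  numbers (the point at infinity is always smooth).\<close>

lemma elliptic_curve_iff_smooth:
  "elliptic_curve g2 g3 \<longleftrightarrow>
    \<not> (\<exists>x y :: complex. y ^ 2 = 4 * x ^ 3 - of_real g2 * x - of_real g3
          \<and> 2 * y = 0 \<and> 12 * x ^ 2 - of_real g2 = 0)"
proof -
  have "g2 ^ 3 - 27 * g3 ^ 2 = 0"
    if "y ^ 2 = 4 * x ^ 3 - of_real g2 * x - of_real g3" "2 * y = 0"
       "12 * x ^ 2 - of_real g2 = 0" for x y :: complex
  proof -
    have y: "y = 0" and g2: "complex_of_real g2 = 12 * x ^ 2"
      using that by simp_all
    have g3: "complex_of_real g3 = - 8 * x ^ 3"
      using that(1) y g2 by algebra
    have "complex_of_real (g2 ^ 3 - 27 * g3 ^ 2) = 0"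
      by (simp add: g2 g3 power_mult_distrib flip: power_mult)
    then show ?thesis
      by (simp only: of_real_eq_0_iff)
  qed
  moreover have "\<exists>x y :: complex. y ^ 2 = 4 * x ^ 3 - of_real g2 * x - of_real g3
          \<and> 2 * y = 0 \<and> 12 * x ^ 2 - of_real g2 = 0" if 0: "g2 ^ 3 - 27 * g3 ^ 2 = 0"
  proof -
    have "\<exists>x :: real. 4 * x ^ 3 - g2 * x - g3 = 0 \<and> 12 * x ^ 2 - g2 = 0"
    proof (cases "g2 = 0")
      case True
      with 0 show ?thesis by (intro exI[of _ 0]) auto
    next
      case False
      define x where "x = - 3 * g3 / (2 * g2)"
      have sq: "12 * x ^ 2 = g2"
        using 0 False by (simp add: x_def field_simps power2_eq_square power3_eq_cube)
      have "2 * (g2 * x) = - 3 * g3"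
        using False by (simp add: x_def)
      moreover have "12 * x ^ 3 = g2 * x"
        by (simp add: power3_eq_cube power2_eq_square flip: sq)
      ultimately have "4 * x ^ 3 - g2 * x - g3 = 0"
        by simp
      with sq show ?thesis by auto
    qed
    then obtain x :: real where x: "4 * x ^ 3 - g2 * x - g3 = 0" "12 * x ^ 2 - g2 = 0"
      by blast
    from arg_cong[OF x(1), of complex_of_real] arg_cong[OF x(2), of complex_of_real]
    show ?thesis
      by (intro exI[of _ "of_real x"] exI[of _ 0]) simp
  qed
  ultimately show ?thesis
    unfolding elliptic_curve_def by blast
qed

datatype ec_point = Infinity | Affine (x_coord: real) (y_coord: real)

definition ec_points :: "real \<Rightarrow> real \<Rightarrow> ec_point set" where
  "ec_points g2 g3 =
    insert Infinity {Affine x y | x y. y ^ 2 = 4 * x ^ 3 - g2 * x - g3}"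

text \<open>The chord-tangent law. The line of slope \<open>m\<close> through the summands meets the curve in three
  points whose \<open>x\<close>-coordinates sum to \<open>m\<^sup>2 / 4\<close>, the leading coefficient of the cubic being 4.
  The case \<open>x1 = x2 \<and> y1 = - y2\<close> includes doubling a point with \<open>y = 0\<close>.\<close>

fun ec_add :: "real \<Rightarrow> ec_point \<Rightarrow> ec_point \<Rightarrow> ec_point" where
  "ec_add g2 Infinity Q = Q"
| "ec_add g2 P Infinity = P"
| "ec_add g2 (Affine x1 y1) (Affine x2 y2) =
    (if x1 = x2 \<and> y1 = - y2 then Infinity
     else let m = (if x1 = x2 then (12 * x1 ^ 2 - g2) / (2 * y1) else (y2 - y1) / (x2 - x1));
              x3 = m ^ 2 / 4 - x1 - x2
          in Affine x3 (- (y1 + m * (x3 - x1))))"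

definition ec_group :: "real \<Rightarrow> real \<Rightarrow> ec_point monoid" where
  "ec_group g2 g3 = \<lparr>carrier = ec_points g2 g3, mult = ec_add g2, one = Infinity\<rparr>"

lemma ec_add_closed:
  assumes "P \<in> ec_points g2 g3" "Q \<in> ec_points g2 g3"
  shows "ec_add g2 P Q \<in> ec_points g2 g3"
proof (cases "P = Infinity \<or> Q = Infinity")
  case True
  then show ?thesis using assms by (cases P; cases Q) auto
next
  case False
  then obtain x1 y1 x2 y2 where PQ: "P = Affine x1 y1" "Q = Affine x2 y2"
    by (cases P; cases Q) auto
  have e1: "y1 ^ 2 = 4 * x1 ^ 3 - g2 * x1 - g3" and e2: "y2 ^ 2 = 4 * x2 ^ 3 - g2 * x2 - g3"
    using assms by (auto simp: PQ ec_points_def)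
  show ?thesis
  proof (cases "x1 = x2 \<and> y1 = - y2")
    case True
    then show ?thesis by (simp add: PQ ec_points_def)
  next
    case ne: False
    define m where "m = (if x1 = x2 then (12 * x1 ^ 2 - g2) / (2 * y1) else (y2 - y1) / (x2 - x1))"
    define x3 where "x3 = m ^ 2 / 4 - x1 - x2"
    have g2: "g2 = 4 * (x1 ^ 2 + x1 * x2 + x2 ^ 2) - m * (2 * y1 + m * (x2 - x1))"
    proof (cases "x1 = x2")
      case True
      have "(y1 - y2) * (y1 + y2) = 0"
        using e1 e2 True by (simp add: power2_eq_square algebra_simps)
      with ne True have "y1 \<noteq> 0" by auto
      then have "m * (2 * y1) = 12 * x1 ^ 2 - g2" by (simp add: m_def True)
      then show ?thesis using True by (simp add: power2_eq_square)
    next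
      case False
      then have y2: "y2 = y1 + m * (x2 - x1)" by (simp add: m_def)
      have "(x2 - x1) * (4 * (x1 ^ 2 + x1 * x2 + x2 ^ 2) - m * (2 * y1 + m * (x2 - x1)) - g2) = 0"
        using e1 e2 unfolding y2 by (simp add: power2_eq_square power3_eq_cube algebra_simps)
      then show ?thesis using False by simp
    qed
    have g3: "g3 = 4 * x1 ^ 3 - g2 * x1 - y1 ^ 2"
      using e1 by simp
    have "(y1 + m * (x3 - x1)) ^ 2 = 4 * x3 ^ 3 - g2 * x3 - g3"
      unfolding g3 g2 x3_def by (simp add: power2_eq_square power3_eq_cube field_simps)
    moreover have "ec_add g2 P Q = Affine x3 (- (y1 + m * (x3 - x1)))"
      using ne by (simp add: PQ m_def x3_def Let_def)
    ultimately show ?thesis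
      unfolding ec_points_def by (auto simp del: minus_add_distrib)
  qed
qed

end

theory Submission imports Defs "HOL-Analysis.Analysis" begin

text \<open>
  Let \<open>e\<close> be the largest real root of \<open>4x\<^sup>3 - g2 x - g3\<close>. For suitable \<open>r > 0\<close> and a real
  parameter \<open>k < 1\<close> (possibly negative), the identity component of the curve is parametrised by
  Jacobi functions with parameter \<open>k\<close>:
  \<open>x = e + r\<^sup>2 (1 + cn u) / (1 - cn u)\<close>, \<open>y = 4 r\<^sup>3 sn u dn u / (1 - cn u)\<^sup>2\<close>.
  Here \<open>sn\<close>, \<open>cn\<close>, \<open>dn\<close> are smooth on the whole real line, and as \<open>k < 1\<close> the denominator
  \<open>1 - k sn\<^sup>2 u sn\<^sup>2 v\<close> of their addition theorem never vanishes. Through the addition theorem the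
  chord-tangent law becomes addition of parameters, so the multiple \<open>nP\<close> of the point with
  parameter \<open>t\<close> has parameter \<open>n t\<close>. Both coordinates tend to infinity as \<open>u\<close> decreases to 0, so it
  suffices to choose \<open>t\<close>, by Baire's theorem, as an irrational multiple of the period such that
  \<open>n t\<close> is infinitely often just above a multiple of the period, as closely as \<open>\<psi> n\<close> demands.
  Irrationality leaves only generic chords and a single doubling to be computed.
\<close>

section \<open>The incomplete elliptic integral of the first kind\<close>

lemma one_minus_mult_sin_squared_pos:
  fixes k x :: real
  assumes "k < 1"
  shows "1 - k * sin x ^ 2 > 0"
proof -
  \<comment> \<open>For negative \<open>k\<close> the product is at most 0, so
    \<open>max k 0\<close> serves for either sign.\<close>
  have "k * sin x ^ 2 \<le> max k 0 * 1"
    by (intro mult_mono) (auto simp: abs_square_le_1)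
  with assms show ?thesis by linarith
qed

text \<open>\<open>F\<close> is the incomplete elliptic integral of the first kind with parameter
  \<open>k\<close> (the squared modulus in the classical range), characterised by its derivative and
  its value at 0.\<close>

locale elliptic_integral =
  fixes k :: real and F :: "real \<Rightarrow> real"
  assumes k_less_1: "k < 1"
    and F_0: "F 0 = 0"
    and F_deriv: "(F has_real_derivative 1 / sqrt (1 - k * sin x ^ 2)) (at x)"

lemma elliptic_integral_exists:
  assumes "k < 1"
  obtains F where "elliptic_integral k F"
proof -
  note pos = one_minus_mult_sin_squared_pos[OF assms]
  have "isCont (\<lambda>x. 1 / sqrt (1 - k * sin x ^ 2)) x" for x
    using pos[of x] by (intro continuous_intros) auto
  then obtain G where G: "\<And>x::real. (G has_vector_derivative 1 / sqrt (1 - k * sin x ^ 2)) (at x)"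
    using einterval_antiderivative[of "-\<infinity>" "\<infinity>" "\<lambda>x. 1 / sqrt (1 - k * sin x ^ 2)"] by auto
  show ?thesis
  proof
    show "elliptic_integral k (\<lambda>x. G x - G 0)"
      using assms G by unfold_locales
        (auto simp: has_real_derivative_iff_has_vector_derivative intro!: derivative_eq_intros)
  qed
qed

context elliptic_integral
begin

lemmas radicand_pos = one_minus_mult_sin_squared_pos[OF k_less_1]

lemma strict_mono_F: "strict_mono F"
  by (rule strict_monoI, rule DERIV_pos_imp_increasing)
     (use F_deriv radicand_pos in \<open>auto intro!: exI\<close>)

lemma isCont_F: "isCont F x"
  using F_deriv DERIV_isCont by blast

lemma F_minus: "F (- x) = - F x"
proof -
  have "((\<lambda>x. F x + F (- x)) has_real_derivative 0) (at x)" for x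
    by (rule derivative_eq_intros F_deriv DERIV_chain2[where f = F] refl)+ simp
  then have "F x + F (- x) = F 0 + F (- 0)"
    by (rule DERIV_isconst_all[rule_format, of "\<lambda>x. F x + F (- x)"])
  then show ?thesis by (simp add: F_0)
qed

lemma F_add_period: "F (x + 2 * pi) = F x + F (2 * pi)"
proof -
  have "((\<lambda>x. F (x + 2 * pi) - F x) has_real_derivative 0) (at x)" for x
    by (rule derivative_eq_intros F_deriv DERIV_chain2[where f = F] refl)+ simp
  then have "F (x + 2 * pi) - F x = F (0 + 2 * pi) - F 0"
    by (rule DERIV_isconst_all[rule_format, of "\<lambda>x. F (x + 2 * pi) - F x"])
  then show ?thesis by (simp add: F_0)
qed

text \<open>In classical notation this is 4K, a common period of \<open>sn\<close>,
  \<open>cn\<close> and \<open>dn\<close>.\<close>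

definition period :: real where "period = F (2 * pi)"

lemma period_pos: "period > 0"
  using strict_monoD[OF strict_mono_F, of 0 "2 * pi"] by (simp add: period_def F_0)

lemma F_add_periods: "F (x + 2 * of_int n * pi) = F x + of_int n * period"
proof (induction n rule: int_induct[of _ 0])
  case base
  then show ?case by simp
next
  case (step1 n)
  then show ?case
    using F_add_period[of "x + 2 * of_int n * pi"] by (simp add: period_def algebra_simps)
next
  case (step2 n)
  then show ?case
    using F_add_period[of "x + 2 * of_int (n - 1) * pi"] by (simp add: period_def algebra_simps)
qed

lemma surj_F: "surj F"
proof -
  have "\<exists>x. F x = y" for y
  proof -
    obtain n :: nat where n: "\<bar>y\<bar> < of_nat n * period"
      using reals_Archimedean3[OF period_pos] by blast
    have "F (2 * of_nat n * pi) = of_nat n * period"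
      using F_add_periods[of 0 "int n"] by (simp add: F_0)
    moreover from this have "F (- (2 * of_nat n * pi)) = - (of_nat n * period)"
      by (simp only: F_minus)
    ultimately show ?thesis
      using IVT[of F "- (2 * of_nat n * pi)" y "2 * of_nat n * pi"] n isCont_F by force
  qed
  then show ?thesis by (metis surjI)
qed

section \<open>The Jacobi amplitude and the functions sn, cn, dn\<close>

definition am :: "real \<Rightarrow> real" where "am = inv_into UNIV F"

lemma F_am [simp]: "F (am u) = u"
  by (simp add: am_def surj_F surj_f_inv_f)

lemma am_F [simp]: "am (F x) = x"
  by (simp add: am_def strict_mono_F strict_mono_imp_inj_on)

lemma am_0: "am 0 = 0"
  using am_F[of 0] by (simp add: F_0)

lemma strict_mono_am: "strict_mono am"
  by (rule strict_monoI) (metis F_am strict_mono_F strict_mono_less)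

lemma am_deriv: "(am has_real_derivative sqrt (1 - k * sin (am u) ^ 2)) (at u)"
proof -
  have "isCont am u"
    using isCont_inverse_function[of 1 "am u" am F] isCont_F by simp
  then have "(am has_real_derivative inverse (1 / sqrt (1 - k * sin (am u) ^ 2))) (at u)"
    using radicand_pos[of "am u"]
    by (intro DERIV_inverse_function[OF F_deriv, of _ _ "u - 1" "u + 1"]) auto
  then show ?thesis by simp
qed

definition sn :: "real \<Rightarrow> real" where "sn u = sin (am u)"
definition cn :: "real \<Rightarrow> real" where "cn u = cos (am u)"
text \<open>The positive root is right on the whole line: for \<open>k < 1\<close> the radicand
  never vanishes, and this root is the derivative of \<open>am\<close>.\<close>

definition dn :: "real \<Rightarrow> real" where "dn u = sqrt (1 - k * sn u ^ 2)"

lemma jacobi_0 [simp]: "sn 0 = 0" "cn 0 = 1" "dn 0 = 1"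
  by (simp_all add: sn_def cn_def dn_def am_0)

lemma dn_pos: "dn u > 0"
  using radicand_pos[of "am u"] by (simp add: dn_def sn_def)

lemma sn_cn_squared: "sn u ^ 2 + cn u ^ 2 = 1"
  by (simp add: sn_def cn_def)

lemma dn_squared: "dn u ^ 2 = 1 - k * sn u ^ 2"
  using radicand_pos[of "am u"] by (simp add: dn_def sn_def)

lemma sn_deriv: "(sn has_real_derivative cn u * dn u) (at u)"
  unfolding sn_def [abs_def] cn_def dn_def
  by (rule derivative_eq_intros am_deriv refl)+

lemma cn_deriv: "(cn has_real_derivative - sn u * dn u) (at u)"
  unfolding sn_def cn_def [abs_def] dn_def
  by (rule derivative_eq_intros am_deriv refl)+

lemma dn_deriv: "(dn has_real_derivative - k * sn u * cn u) (at u)"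
proof -
  have pos: "1 - k * sn u ^ 2 > 0"
    using radicand_pos[of "am u"] by (simp add: sn_def)
  have "((\<lambda>u. 1 - k * sn u ^ 2) has_real_derivative - (2 * k * sn u * cn u * dn u)) (at u)"
    by (rule derivative_eq_intros sn_deriv refl)+ simp
  from DERIV_chain2[OF DERIV_real_sqrt[OF pos] this] show ?thesis
    unfolding dn_def [symmetric, abs_def] using dn_pos[of u] by (simp add: field_simps)
qed

section \<open>The addition theorem\<close>

lemma addition_denominator_pos: "1 - k * sn u ^ 2 * sn v ^ 2 > 0"
proof -
  have "k * (sn u ^ 2 * sn v ^ 2) \<le> max k 0 * (1 * 1)"
    by (intro mult_mono) (auto simp: sn_def abs_square_le_1)
  with k_less_1 show ?thesis by (simp add: mult.assoc)
qed

lemma jacobi_reflected_deriv: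
  "((\<lambda>x. sn (c - x)) has_real_derivative - (cn (c - x) * dn (c - x))) (at x)"
  "((\<lambda>x. cn (c - x)) has_real_derivative sn (c - x) * dn (c - x)) (at x)"
  "((\<lambda>x. dn (c - x)) has_real_derivative k * sn (c - x) * cn (c - x)) (at x)"
proof -
  have d: "((-) c has_real_derivative -1) (at x)"
    by (auto intro!: derivative_eq_intros)
  from DERIV_chain2[OF sn_deriv d] DERIV_chain2[OF cn_deriv d] DERIV_chain2[OF dn_deriv d] show
    "((\<lambda>x. sn (c - x)) has_real_derivative - (cn (c - x) * dn (c - x))) (at x)"
    "((\<lambda>x. cn (c - x)) has_real_derivative sn (c - x) * dn (c - x)) (at x)"
    "((\<lambda>x. dn (c - x)) has_real_derivative k * sn (c - x) * cn (c - x)) (at x)"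
    by simp_all
qed

lemma addition_denominator_deriv:
  "((\<lambda>x. 1 - k * sn x ^ 2 * sn (c - x) ^ 2) has_real_derivative
     - 2 * k * sn x * sn (c - x) * (cn x * dn x * sn (c - x) - sn x * cn (c - x) * dn (c - x))) (at x)"
  by (rule derivative_eq_intros sn_deriv jacobi_reflected_deriv refl)+
     (simp add: algebra_simps power2_eq_square)

text \<open>The addition formulas are obtained by differentiating along the line where the two arguments
  have the constant sum \<open>c\<close>.\<close>

lemma addition_quotient_const:
  assumes N: "\<And>x. (N has_real_derivative N' x) (at x)"
    and eq: "\<And>x. N' x * (1 - k * sn x ^ 2 * sn (c - x) ^ 2) =
      N x * (- 2 * k * sn x * sn (c - x) * (cn x * dn x * sn (c - x) - sn x * cn (c - x) * dn (c - x)))"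
  shows "N x / (1 - k * sn x ^ 2 * sn (c - x) ^ 2) = N 0"
proof -
  define f where "f x = N x / (1 - k * sn x ^ 2 * sn (c - x) ^ 2)" for x
  \<comment> \<open>By \<open>eq\<close> the numerator in the quotient rule vanishes. At 0 the
    denominator is 1, so the constant value is \<open>N 0\<close>.\<close>
  have "(f has_real_derivative 0) (at x)" for x
    unfolding f_def [abs_def]
    using DERIV_divide[OF N addition_denominator_deriv[of c], of x]
      addition_denominator_pos[of x "c - x"] eq[of x] by simp
  then have "f x = f 0"
    by (rule DERIV_isconst_all[rule_format, of f])
  then show ?thesis by (simp add: f_def)
qed

text \<open>The numerator, with \<open>v\<close> replaced by \<open>c - x\<close>, equals
  \<open>sn c\<close> at \<open>x = 0\<close>, so constancy of the quotient is the addition formula.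
  The formulas for \<open>cn\<close> and \<open>dn\<close> follow the same pattern.\<close>

lemma sn_add:
  "sn (u + v) = (sn u * cn v * dn v + sn v * cn u * dn u) / (1 - k * sn u ^ 2 * sn v ^ 2)"
proof -
  define c where "c = u + v"
  define N where "N x = sn x * cn (c - x) * dn (c - x) + sn (c - x) * cn x * dn x" for x
  \<comment> \<open>In the product rule the two terms
    \<open>cn x * dn x * cn (c - x) * dn (c - x)\<close> cancel.\<close>
  define N' where "N' x = sn x * sn (c - x) * 
     (dn (c - x) ^ 2 + k * cn (c - x) ^ 2 - dn x ^ 2 - k * cn x ^ 2)" for x
  have "(N has_real_derivative N' x) (at x)" for x
    unfolding N_def [abs_def] N'_def
    by (rule derivative_eq_intros sn_deriv cn_deriv dn_deriv jacobi_reflected_deriv refl)+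
       (simp add: algebra_simps power2_eq_square)
  then have "N u / (1 - k * sn u ^ 2 * sn (c - u) ^ 2) = N 0"
  proof (rule addition_quotient_const)
    fix x
    note rel = sn_cn_squared[of x] sn_cn_squared[of "c - x"] dn_squared[of x] dn_squared[of "c - x"]
    show "N' x * (1 - k * sn x ^ 2 * sn (c - x) ^ 2) =
      N x * (- 2 * k * sn x * sn (c - x) * (cn x * dn x * sn (c - x) - sn x * cn (c - x) * dn (c - x)))"
      using rel unfolding N_def N'_def by algebra
  qed
  then show ?thesis by (simp add: N_def c_def)
qed

lemma cn_add:
  "cn (u + v) = (cn u * cn v - sn u * sn v * dn u * dn v) / (1 - k * sn u ^ 2 * sn v ^ 2)"
proof -
  define c where "c = u + v"
  define N where "N x = cn x * cn (c - x) - sn x * sn (c - x) * dn x * dn (c - x)" for x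
  define N' where "N' x = - sn x * dn x * cn (c - x) + cn x * sn (c - x) * dn (c - x)
     - (cn x * dn x * sn (c - x) - sn x * cn (c - x) * dn (c - x)) * dn x * dn (c - x)
     - sn x * sn (c - x) * (k * sn (c - x) * cn (c - x) * dn x - k * sn x * cn x * dn (c - x))" for x
  have "(N has_real_derivative N' x) (at x)" for x
    unfolding N_def [abs_def] N'_def
    by (rule derivative_eq_intros sn_deriv cn_deriv dn_deriv jacobi_reflected_deriv refl)+
       (simp add: algebra_simps power2_eq_square)
  then have "N u / (1 - k * sn u ^ 2 * sn (c - u) ^ 2) = N 0"
  proof (rule addition_quotient_const)
    fix x
    note rel = sn_cn_squared[of x] sn_cn_squared[of "c - x"] dn_squared[of x] dn_squared[of "c - x"]
    show "N' x * (1 - k * sn x ^ 2 * sn (c - x) ^ 2) =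
      N x * (- 2 * k * sn x * sn (c - x) * (cn x * dn x * sn (c - x) - sn x * cn (c - x) * dn (c - x)))"
      using rel unfolding N_def N'_def by algebra
  qed
  then show ?thesis by (simp add: N_def c_def)
qed

lemma dn_add:
  "dn (u + v) = (dn u * dn v - k * sn u * sn v * cn u * cn v) / (1 - k * sn u ^ 2 * sn v ^ 2)"
proof -
  define c where "c = u + v"
  define N where "N x = dn x * dn (c - x) - k * sn x * sn (c - x) * cn x * cn (c - x)" for x
  define N' where "N' x = - k * sn x * cn x * dn (c - x) + k * dn x * sn (c - x) * cn (c - x)
     - k * (cn x * dn x * sn (c - x) - sn x * cn (c - x) * dn (c - x)) * cn x * cn (c - x)
     - k * sn x * sn (c - x) * (sn (c - x) * dn (c - x) * cn x - sn x * dn x * cn (c - x))" for x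
  have "(N has_real_derivative N' x) (at x)" for x
    unfolding N_def [abs_def] N'_def
    by (rule derivative_eq_intros sn_deriv cn_deriv dn_deriv jacobi_reflected_deriv refl)+
       (simp add: algebra_simps power2_eq_square)
  then have "N u / (1 - k * sn u ^ 2 * sn (c - u) ^ 2) = N 0"
  proof (rule addition_quotient_const)
    fix x
    note rel = sn_cn_squared[of x] sn_cn_squared[of "c - x"] dn_squared[of x] dn_squared[of "c - x"]
    show "N' x * (1 - k * sn x ^ 2 * sn (c - x) ^ 2) =
      N x * (- 2 * k * sn x * sn (c - x) * (cn x * dn x * sn (c - x) - sn x * cn (c - x) * dn (c - x)))"
      using rel unfolding N_def N'_def by algebra
  qed
  then show ?thesis by (simp add: N_def c_def)
qed

section \<open>Periodicity and behaviour near the pole\<close>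

text \<open>The corresponding fact about \<open>cos\<close> holds for the amplitudes, and
  \<open>F\<close>, being odd and compatible with shifts by \<open>2 * pi\<close>, carries it over.
  It decides when two parameters give the same abscissa, which depends on \<open>cn\<close>
  alone.\<close>

lemma cn_eq_imp:
  assumes "cn u = cn v"
  shows "\<exists>n::int. u = v + of_int n * period \<or> u = - v + of_int n * period"
proof -
  obtain n :: int where "am u = am v + 2 * of_int n * pi \<or> am u = - am v + 2 * of_int n * pi"
    using assms unfolding cn_def cos_eq by (auto elim!: Ints_cases)
  then have "F (am u) = F (am v) + of_int n * period \<or> F (am u) = F (- am v) + of_int n * period"
    using F_add_periods by metis
  then show ?thesis by (auto simp: F_minus)
qed

lemma am_add_periods: "am (u + of_int n * period) = am u + 2 * of_int n * pi"
  by (metis F_add_periods F_am am_F)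

lemma jacobi_add_periods [simp]:
  "sn (u + of_int n * period) = sn u"
  "cn (u + of_int n * period) = cn u"
  "dn (u + of_int n * period) = dn u"
  using sin_integer_2pi[of "of_int n"] cos_integer_2pi[of "of_int n"]
  by (simp_all add: sn_def cn_def dn_def am_add_periods sin_add cos_add mult_ac)

text \<open>The parameter 0 stands for the point at infinity. Approaching it from the right makes
  \<open>sn\<close>, and with it the ordinate, positive.\<close>

lemma eventually_near_pole:
  "\<forall>\<^sub>F u in at_right 0. sn u > 0 \<and> cn u < 1 \<and> dn u > 1/2 \<and> (1 + cn u) / (1 - cn u) > B"
proof -
  have am: "(am \<longlongrightarrow> 0) (at_right 0)"
    using DERIV_isCont[OF am_deriv, of 0] am_0
    by (simp add: isCont_def filterlim_at_split)
  have cn: "(cn \<longlongrightarrow> 1) (at_right 0)" and dn: "(dn \<longlongrightarrow> 1) (at_right 0)"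
    using DERIV_isCont[OF cn_deriv, of 0] DERIV_isCont[OF dn_deriv, of 0]
    by (simp_all add: isCont_def filterlim_at_split)
  \<comment> \<open>The bound on the quotient is multiplied out, so that a finite positive limit
    decides it.\<close>
  have lim: "((\<lambda>u. 1 + cn u - B * (1 - cn u)) \<longlongrightarrow> 1 + 1 - B * (1 - 1)) (at_right 0)"
    by (intro tendsto_intros cn)
  have "\<forall>\<^sub>F u in at_right 0. am u < pi"
    using order_tendstoD(2)[OF am, of pi] by simp
  moreover have "\<forall>\<^sub>F u in at_right 0. dn u > 1/2"
    using order_tendstoD(1)[OF dn, of "1/2"] by simp
  moreover have "\<forall>\<^sub>F u in at_right 0. 1 + cn u - B * (1 - cn u) > 0"
    using order_tendstoD(1)[OF lim, of 0] by simp
  moreover have "\<forall>\<^sub>F u in at_right (0::real). u > 0"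
    by (rule eventually_at_right_less)
  ultimately show ?thesis
  proof eventually_elim
    case (elim u)
    have "am u > 0"
      using elim strict_monoD[OF strict_mono_am, of 0 u] by (simp add: am_0)
    with elim have sn: "sn u > 0"
      by (simp add: sn_def sin_gt_zero)
    have "cn u \<noteq> 1"
      using sn sn_cn_squared[of u] by auto
    moreover have "cn u \<le> 1"
      by (simp add: cn_def)
    ultimately show ?case
      using elim sn by (simp add: field_simps)
  qed
qed

end

section \<open>Chords and tangents on the normalised curve\<close>

text \<open>The relations give \<open>X = s^2 / (1 - c)^2\<close> and
  \<open>X^2 + (2 - 4 * k) * X + 1 = 4 * d^2 / (1 - c)^2\<close>; the product of the two is
  \<open>4 * Y^2\<close>.\<close>

lemma jacobi_quartic:
  fixes s c d k :: real
  assumes rel: "s^2 + c^2 = 1" "d^2 = 1 - k * s^2" and "c \<noteq> 1"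
  defines "X \<equiv> (1 + c) / (1 - c)" and "Y \<equiv> s * d / (1 - c)^2"
  shows "4 * Y^2 = X * (X^2 + (2 - 4 * k) * X + 1)"
proof -
  have "X * (1 - c) = 1 + c" "Y * (1 - c)^2 = s * d" "1 - c \<noteq> 0"
    using \<open>c \<noteq> 1\<close> by (simp_all add: X_def Y_def)
  then have "(1 - c)^4 * (4 * Y^2) = (1 - c)^4 * (X * (X^2 + (2 - 4 * k) * X + 1))"
    using rel by algebra
  then show ?thesis using \<open>1 - c \<noteq> 0\<close> by simp
qed

text \<open>Since \<open>(1 + c) * (1 - c) = s^2\<close>, the denominators can be traded for powers
  of \<open>s\<close>. In particular the ordinate times \<open>s\<close> is \<open>d\<close> times
  the abscissa.\<close>

lemma jacobi_coordinates:
  fixes s c d :: real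
  assumes "s^2 + c^2 = 1" "s \<noteq> 0"
  shows "c \<noteq> 1" "c \<noteq> -1" "(1 + c) / (1 - c) = (1 + c)^2 / s^2"
    "s * d / (1 - c)^2 = d * (1 + c)^2 / s^3"
proof -
  show c: "c \<noteq> 1" "c \<noteq> -1" using assms by auto
  have s2: "s^2 = (1 + c) * (1 - c)" using assms by algebra
  then show "(1 + c) / (1 - c) = (1 + c)^2 / s^2"
    using c by (simp add: power2_eq_square)
  have "s^3 * (s * d) = (1 - c)^2 * (d * (1 + c)^2)" using s2 by algebra
  then show "s * d / (1 - c)^2 = d * (1 + c)^2 / s^3"
    using c assms by (simp add: frac_eq_eq mult_ac)
qed

text \<open>The addition theorem enters as equations for \<open>s3\<close>, \<open>c3\<close>,
  \<open>d3\<close>, so only algebra remains. Substituting a line of slope \<open>M\<close> into the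
  curve gives a cubic whose roots sum to \<open>4 * M^2 - (2 - 4 * k)\<close>, which explains the
  formula for the third abscissa.\<close>

lemma jacobi_chord:
  fixes s1 c1 d1 s2 c2 d2 k :: real
  assumes rel: "s1^2 + c1^2 = 1" "s2^2 + c2^2 = 1" "d1^2 = 1 - k * s1^2" "d2^2 = 1 - k * s2^2"
      "s3^2 + c3^2 = 1"
    and nz: "s1 \<noteq> 0" "s2 \<noteq> 0" "c1 \<noteq> c2" "c3 \<noteq> 1" "1 - k * s1^2 * s2^2 \<noteq> 0"
    and s3: "s3 = (s1 * c2 * d2 + s2 * c1 * d1) / (1 - k * s1^2 * s2^2)"
    and c3: "c3 = (c1 * c2 - s1 * s2 * d1 * d2) / (1 - k * s1^2 * s2^2)"
    and d3: "d3 = (d1 * d2 - k * s1 * s2 * c1 * c2) / (1 - k * s1^2 * s2^2)"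
  defines "X1 \<equiv> (1 + c1) / (1 - c1)" and "Y1 \<equiv> s1 * d1 / (1 - c1)^2"
    and "X2 \<equiv> (1 + c2) / (1 - c2)" and "Y2 \<equiv> s2 * d2 / (1 - c2)^2"
    and "X3 \<equiv> (1 + c3) / (1 - c3)" and "Y3 \<equiv> s3 * d3 / (1 - c3)^2"
  defines "M \<equiv> (Y2 - Y1) / (X2 - X1)"
  shows "X1 \<noteq> X2" "4 * M^2 - X1 - X2 - (2 - 4 * k) = X3" "- (Y1 + M * (X3 - X1)) = Y3"
proof -
  \<comment> \<open>As the product of the abscissas is 4 times the square of the intercept of the line,
    \<open>X3\<close> is the square of \<open>w\<close>.\<close>
  define w where "w = (d1 * s2 - d2 * s1) / (c1 - c2)"
  define \<Delta> where "\<Delta> = 1 - k * s1^2 * s2^2"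
  note j1 = jacobi_coordinates[OF rel(1) nz(1)] and j2 = jacobi_coordinates[OF rel(2) nz(2)]
  have \<Delta>: "\<Delta> \<noteq> 0" "s3 * \<Delta> = s1 * c2 * d2 + s2 * c1 * d1" "c3 * \<Delta> = c1 * c2 - s1 * s2 * d1 * d2"
      "d3 * \<Delta> = d1 * d2 - k * s1 * s2 * c1 * c2"
    using nz(5) by (simp_all add: s3 c3 d3 \<Delta>_def)
  have w: "w * (c1 - c2) = d1 * s2 - d2 * s1"
    using nz by (simp add: w_def)
  \<comment> \<open>This identifies \<open>w\<close> with \<open>s3 / (1 - c3)\<close>, the
    cotangent of half the amplitude of the sum.\<close>
  have "\<Delta> * (c1 - c2) * s3 = \<Delta> * (c1 - c2) * (w * (1 - c3))"
  proof -
    have "(s1 * c2 * d2 + s2 * c1 * d1) * (c1 - c2)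
        = (1 - k * s1^2 * s2^2 - (c1 * c2 - s1 * s2 * d1 * d2)) * (d1 * s2 - d2 * s1)"
      using rel(1-4) by algebra
    then have "s3 * \<Delta> * (c1 - c2) = (\<Delta> - c3 * \<Delta>) * (w * (c1 - c2))"
      unfolding \<Delta>(2,3) w by (simp add: \<Delta>_def)
    then show ?thesis by (simp add: algebra_simps)
  qed
  then have s3w: "s3 = w * (1 - c3)" using \<Delta>(1) nz by simp
  have "(1 - c3) * (1 + c3) = (1 - c3) * (w^2 * (1 - c3))"
    using rel(5) s3w by algebra
  then have c3w: "1 + c3 = w^2 * (1 - c3)" using nz by simp
  then have X3: "X3 = w^2" using nz by (simp add: X3_def)
  have cX: "X1 * (1 - c1) = 1 + c1" "X2 * (1 - c2) = 1 + c2"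
    using j1(1) j2(1) by (simp_all add: X1_def X2_def)
  then have Xdiff: "(X2 - X1) * ((1 - c1) * (1 - c2)) = 2 * (c2 - c1)"
    by algebra
  then show "X1 \<noteq> X2" using nz by auto
  then have ne: "X2 - X1 \<noteq> 0" by simp
  have q1: "4 * Y1^2 = X1 * (X1^2 + (2 - 4 * k) * X1 + 1)"
    unfolding X1_def Y1_def by (rule jacobi_quartic) (use rel j1 in auto)
  have q2: "4 * Y2^2 = X2 * (X2^2 + (2 - 4 * k) * X2 + 1)"
    unfolding X2_def Y2_def by (rule jacobi_quartic) (use rel j2 in auto)
  have M: "M * (X2 - X1) = Y2 - Y1" using ne by (simp add: M_def)
  have Xnz: "X1 \<noteq> 0" "X2 \<noteq> 0" using j1 j2 by (auto simp: X1_def X2_def)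
  have cY: "Y1 * s1 = d1 * X1" "Y2 * s2 = d2 * X2"
    using j1(3,4) j2(3,4) nz unfolding X1_def X2_def Y1_def Y2_def
    by (simp_all add: power2_eq_square power3_eq_cube)
  \<comment> \<open>\<open>Y1 - M * X1\<close> is the intercept of the line; \<open>B'\<close>
    relates it to the numerator of \<open>w\<close>.\<close>
  have B: "Y1 * X2 - Y2 * X1 = (Y1 - M * X1) * (X2 - X1)"
    using M by algebra
  have B': "(Y1 * X2 - Y2 * X1) * (s1 * s2) = X1 * X2 * (d1 * s2 - d2 * s1)"
    using cY by algebra
  \<comment> \<open>Vieta's formula for the product of the three abscissas, multiplied by
    \<open>(X2 - X1)^2\<close>.\<close>
  have "X1 * X2 * (4 * (Y2 - Y1)^2 - (X1 + X2 + (2 - 4 * k)) * (X2 - X1)^2) = 4 * (Y1 * X2 - Y2 * X1)^2"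
    using q1 q2 by algebra
  then have v: "X1 * X2 * ((4 * M^2 - X1 - X2 - (2 - 4 * k)) * (X2 - X1)^2) = 4 * (Y1 * X2 - Y2 * X1)^2"
    using M by algebra
  have "4 * M^2 - X1 - X2 - (2 - 4 * k) = w^2"
  proof -
    define Z where "Z = 4 * M^2 - X1 - X2 - (2 - 4 * k)"
    have "X1 * X2 * (Z * (X2 - X1)^2) * (s1 * s2)^2 = 4 * (X1 * X2 * (d1 * s2 - d2 * s1))^2"
      unfolding v[folded Z_def] B'[symmetric] by (simp add: power_mult_distrib)
    then have "(X1 * X2) * (Z * (X2 - X1)^2 * (s1 * s2)^2) = (X1 * X2) * (4 * X1 * X2 * (w * (c1 - c2))^2)"
      unfolding w by (simp add: power2_eq_square algebra_simps)
    then have "Z * (X2 - X1)^2 * (s1 * s2)^2 = 4 * X1 * X2 * (w * (c1 - c2))^2"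
      using Xnz by (simp only: mult_cancel_left) simp
    then have "Z * ((X2 - X1) * ((1 - c1) * (1 - c2)))^2 * (s1 * s2)^2
        = 4 * (X1 * (1 - c1)) * (1 - c1) * (X2 * (1 - c2)) * (1 - c2) * (w * (c1 - c2))^2"
      by algebra
    also have "\<dots> = 4 * s1^2 * s2^2 * (w * (c1 - c2))^2"
      unfolding cX using rel by algebra
    finally have "(Z - w^2) * (4 * (s1 * s2 * (c1 - c2))^2) = 0"
      unfolding Xdiff by algebra
    then have "Z = w^2" using nz by simp
    then show ?thesis by (simp add: Z_def)
  qed
  with X3 show "4 * M^2 - X1 - X2 - (2 - 4 * k) = X3" by simp
  \<comment> \<open>This frees \<open>d3\<close> of \<open>\<Delta>\<close>. The factor 2 is
    \<open>(1 - c3) + w^2 * (1 - c3)\<close>, whose second summand is \<open>1 + c3\<close>.\<close>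
  have dd: "d3 * (2 * s1 * s2 * (c1 - c2)^2) = (1 - c3) * ((1 + c1) * (1 + c2) * (c1 - c2)^2
       + (s1 * d2 * (1 - c1) * (1 + c2) - s2 * d1 * (1 - c2) * (1 + c1)) * (d1 * s2 - d2 * s1))" 
    (is "_ = (1 - c3) * ?R")
  proof -
    have "s1 * s2 * (d1 * d2 - k * s1 * s2 * c1 * c2) * ((c1 - c2)^2 + (d1 * s2 - d2 * s1)^2)
        = (1 - k * s1^2 * s2^2) * ?R"
      using rel(1-4) by algebra
    then have "\<Delta> * (s1 * s2 * d3 * ((c1 - c2)^2 + (w * (c1 - c2))^2)) = \<Delta> * ?R"
      unfolding \<Delta>(4)[symmetric] w by (simp add: \<Delta>_def algebra_simps)
    then have "s1 * s2 * d3 * ((c1 - c2)^2 + (w * (c1 - c2))^2) = ?R"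
      using \<Delta>(1) by simp
    then have "(1 - c3) * ?R = s1 * s2 * d3 * (c1 - c2)^2 * ((1 - c3) + w^2 * (1 - c3))"
      by algebra
    then show ?thesis unfolding c3w[symmetric] by simp
  qed
  \<comment> \<open>\<open>MM\<close> and \<open>BB\<close> give slope and intercept with
    denominators cleared.\<close>
  have MM: "M * (2 * (c2 - c1) * s1 * s2) = s1 * d2 * (1 - c1) * (1 + c2) - s2 * d1 * (1 - c2) * (1 + c1)"
  proof -
    have "M * (2 * (c2 - c1) * s1 * s2) = (Y2 - Y1) * ((1 - c1) * (1 - c2)) * s1 * s2"
      unfolding M[symmetric] Xdiff[symmetric] by simp
    also have "\<dots> = (Y2 * s2) * ((1 - c1) * (1 - c2)) * s1 - (Y1 * s1) * ((1 - c1) * (1 - c2)) * s2"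
      by (simp add: algebra_simps)
    also have "\<dots> = d2 * (X2 * (1 - c2)) * (1 - c1) * s1 - d1 * (X1 * (1 - c1)) * (1 - c2) * s2"
      unfolding cY by simp
    finally show ?thesis unfolding cX by (simp add: algebra_simps)
  qed
  have BB: "(Y1 - M * X1) * (2 * s1 * s2) = - (1 + c1) * (1 + c2) * w"
  proof -
    have "(Y1 - M * X1) * ((X2 - X1) * ((1 - c1) * (1 - c2))) * (s1 * s2)
        = (Y1 * X2 - Y2 * X1) * (s1 * s2) * ((1 - c1) * (1 - c2))"
      unfolding B by simp
    also have "\<dots> = (X1 * (1 - c1)) * (X2 * (1 - c2)) * (w * (c1 - c2))"
      unfolding B' w by simp
    finally have "(c1 - c2) * ((Y1 - M * X1) * (2 * s1 * s2)) = (c1 - c2) * (- (1 + c1) * (1 + c2) * w)"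
      unfolding cX Xdiff by algebra
    then show ?thesis using nz by simp
  qed
  \<comment> \<open>The goal is the value \<open>w * d3 / (1 - c3)\<close>, which is
    \<open>Y3\<close> because \<open>s3 = w * (1 - c3)\<close>.\<close>
  have "(1 - c3) * (2 * s1 * s2 * (c1 - c2)^2 * (Y1 - M * X1 + M * w^2))
      = - (2 * s1 * s2 * (c1 - c2)^2 * (w * d3))"
    using dd MM BB w by algebra
  then have "(2 * s1 * s2 * (c1 - c2)^2) * (- (Y1 + M * (w^2 - X1)) * (1 - c3)) =
       (2 * s1 * s2 * (c1 - c2)^2) * (w * d3)"
    by algebra
  then have "- (Y1 + M * (w^2 - X1)) * (1 - c3) = w * d3"
    using nz by simp
  then have "- (Y1 + M * (w^2 - X1)) = w * d3 / (1 - c3)"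
    using nz by (simp add: eq_divide_eq)
  also have "\<dots> = Y3"
    using nz by (simp add: Y3_def s3w power2_eq_square)
  finally show "- (Y1 + M * (X3 - X1)) = Y3"
    by (simp only: X3)
qed

text \<open>Doubling: \<open>M\<close> is the slope found by implicit differentiation of the
  normalised equation.\<close>

lemma jacobi_tangent:
  fixes s c d k :: real
  assumes rel: "s^2 + c^2 = 1" "d^2 = 1 - k * s^2"
    and nz: "s \<noteq> 0" "d \<noteq> 0" "1 - k * s^2 * s^2 \<noteq> 0"
    and s3: "s3 = (s * c * d + s * c * d) / (1 - k * s^2 * s^2)"
    and c3: "c3 = (c * c - s * s * d * d) / (1 - k * s^2 * s^2)"
    and d3: "d3 = (d * d - k * s * s * c * c) / (1 - k * s^2 * s^2)"
  defines "X \<equiv> (1 + c) / (1 - c)" and "Y \<equiv> s * d / (1 - c)^2"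
    and "X3 \<equiv> (1 + c3) / (1 - c3)" and "Y3 \<equiv> s3 * d3 / (1 - c3)^2"
  defines "M \<equiv> (3 * X^2 + 2 * (2 - 4 * k) * X + 1) / (8 * Y)"
  shows "4 * M^2 - X - X - (2 - 4 * k) = X3" "- (Y + M * (X3 - X)) = Y3"
proof -
  define \<Delta> where "\<Delta> = 1 - k * s^2 * s^2"
  note j = jacobi_coordinates[OF rel(1) nz(1)]
  have \<Delta>: "\<Delta> \<noteq> 0" using nz by (simp add: \<Delta>_def)
  \<comment> \<open>Both rest on \<open>\<Delta> = c^2 + s^2 * d^2\<close>.\<close>
  have c3': "1 + c3 = 2 * c^2 / \<Delta>" "1 - c3 = 2 * s^2 * d^2 / \<Delta>"
  proof -
    have "c3 * \<Delta> = c * c - s * s * d * d" using \<Delta> by (simp add: c3 \<Delta>_def)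
    then have "(1 + c3) * \<Delta> = 2 * c^2" "(1 - c3) * \<Delta> = 2 * s^2 * d^2"
      using rel unfolding \<Delta>_def by algebra+
    then show "1 + c3 = 2 * c^2 / \<Delta>" "1 - c3 = 2 * s^2 * d^2 / \<Delta>"
      using \<Delta> by (simp_all add: field_simps)
  qed
  have X3: "X3 = c^2 / (s^2 * d^2)"
    using \<Delta> by (simp add: X3_def c3')
  have X: "X * (1 - c) = 1 + c" "X * s^2 = (1 + c)^2"
    by (use j(1) in \<open>simp add: X_def\<close>) (use j(3)[folded X_def] nz in simp)
  have Y: "Y * (1 - c)^2 = s * d" "Y * s^3 = d * (1 + c)^2"
    by (use j(1) in \<open>simp add: Y_def\<close>) (use j(4)[of d, folded Y_def] nz in simp)
  have M: "M = (2 * d^2 + c) / (2 * s * d)"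
  proof -
    have "(1 - c)^2 * (3 * X^2 + 2 * (2 - 4 * k) * X + 1) = 8 * d^2 + 4 * c"
      using X(1) rel by algebra
    moreover have "M = ((1 - c)^2 * (3 * X^2 + 2 * (2 - 4 * k) * X + 1)) / (8 * (Y * (1 - c)^2))"
      using j by (simp add: M_def)
    ultimately show ?thesis using nz by (simp add: Y(1) field_simps)
  qed
  have "s^2 * d^2 * (4 * M^2 - X - X - (2 - 4 * k)) = c^2"
  proof -
    have "4 * M^2 * (s^2 * d^2) = (2 * d^2 + c)^2"
      using nz by (simp add: M power_divide power_mult_distrib)
    then show ?thesis using X rel by algebra
  qed
  then show "4 * M^2 - X - X - (2 - 4 * k) = X3"
    using nz by (simp add: X3 field_simps)
  have Y3: "Y3 = c * (d^2 - k * s^2 * c^2) / (2 * s^3 * d^3)"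
    unfolding Y3_def c3'(2) s3 d3 \<Delta>_def[symmetric] using nz \<Delta>
    by (simp add: field_simps power2_eq_square power3_eq_cube)
  have "2 * s^3 * d^3 * (- (Y + M * (X3 - X))) = c * (d^2 - k * s^2 * c^2)"
  proof -
    have "M * (2 * s * d) = 2 * d^2 + c" "X3 * (s^2 * d^2) = c^2"
      using nz by (simp_all add: M X3)
    then show ?thesis using X(2) Y(2) rel by algebra
  qed
  then show "- (Y + M * (X3 - X)) = Y3"
    using nz by (simp add: Y3 field_simps)
qed


section \<open>Transfer to the Weierstrass equation\<close>

definition jacobi_point :: "real \<Rightarrow> real \<Rightarrow> real \<Rightarrow> real \<Rightarrow> real \<Rightarrow> ec_point" where
  "jacobi_point e r s c d =
     Affine (e + r^2 * ((1 + c) / (1 - c))) (4 * r^3 * (s * d / (1 - c)^2))"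

text \<open>\<open>g3\<close> makes \<open>e\<close> a root, and \<open>e\<close> and
  \<open>g2\<close> make the substitution \<open>x = e + r^2 * X\<close> turn the cubic into
  \<open>4 * r^6 * X * (X^2 + (2 - 4 * k) * X + 1)\<close>.\<close>

lemma jacobi_point_in_ec_points:
  assumes "s^2 + c^2 = 1" "d^2 = 1 - k * s^2" "c \<noteq> 1"
    and e: "3 * e = r^2 * (2 - 4 * k)" and g2: "g2 = 4 * (3 * e^2 - r^4)"
    and g3: "g3 = 4 * e^3 - g2 * e"
  shows "jacobi_point e r s c d \<in> ec_points g2 g3"
proof -
  define X Y where "X = (1 + c) / (1 - c)" and "Y = s * d / (1 - c)^2"
  have "4 * Y^2 = X * (X^2 + (2 - 4 * k) * X + 1)"
    unfolding X_def Y_def by (rule jacobi_quartic) fact+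
  then have "(4 * r^3 * Y)^2 = 4 * (e + r^2 * X)^3 - g2 * (e + r^2 * X) - g3"
    using e g2 g3 by algebra
  then show ?thesis
    unfolding jacobi_point_def ec_points_def X_def Y_def by blast
qed

text \<open>Slopes scale by \<open>4 * r^3 / r^2\<close>, and \<open>3 * e = r^2 * a\<close> absorbs
  the shift by \<open>e\<close> in the sum of the abscissas. With \<open>M\<close> left open, chord
  and tangent are both covered.\<close>

lemma ec_add_rescaled:
  assumes r: "r \<noteq> 0" and e: "3 * e = r^2 * a"
    and m: "(if x1 = x2 then (12 * x1^2 - g2) / (2 * y1) else (y2 - y1) / (x2 - x1)) = 4 * r * M"
    and ne: "\<not> (x1 = x2 \<and> y1 = - y2)"
    and x1: "x1 = e + r^2 * X1" and x2: "x2 = e + r^2 * X2" and y1: "y1 = 4 * r^3 * Y1"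
    and X3: "4 * M^2 - X1 - X2 - a = X3" and Y3: "- (Y1 + M * (X3 - X1)) = Y3"
  shows "ec_add g2 (Affine x1 y1) (Affine x2 y2) = Affine (e + r^2 * X3) (4 * r^3 * Y3)"
proof -
  have x3: "(4 * r * M)^2 / 4 - x1 - x2 = e + r^2 * X3"
    unfolding x1 x2 X3[symmetric] using e by (simp add: algebra_simps power_mult_distrib)
  have y3: "- (y1 + 4 * r * M * (e + r^2 * X3 - x1)) = 4 * r^3 * Y3"
    unfolding x1 y1 Y3[symmetric] by (simp add: algebra_simps power3_eq_cube power2_eq_square)
  show ?thesis
    using ne by (simp only: ec_add.simps m Let_def x3 y3 if_False)
qed

lemma jacobi_point_chord:
  assumes "r \<noteq> 0" "3 * e = r^2 * (2 - 4 * k)"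
    and "s1^2 + c1^2 = 1" "s2^2 + c2^2 = 1" "d1^2 = 1 - k * s1^2" "d2^2 = 1 - k * s2^2"
      "s3^2 + c3^2 = 1"
    and "s1 \<noteq> 0" "s2 \<noteq> 0" "c1 \<noteq> c2" "c3 \<noteq> 1" "1 - k * s1^2 * s2^2 \<noteq> 0"
    and "s3 = (s1 * c2 * d2 + s2 * c1 * d1) / (1 - k * s1^2 * s2^2)"
    and "c3 = (c1 * c2 - s1 * s2 * d1 * d2) / (1 - k * s1^2 * s2^2)"
    and "d3 = (d1 * d2 - k * s1 * s2 * c1 * c2) / (1 - k * s1^2 * s2^2)"
  shows "ec_add g2 (jacobi_point e r s1 c1 d1) (jacobi_point e r s2 c2 d2) = jacobi_point e r s3 c3 d3"
proof -
  note chord = jacobi_chord[OF assms(3-15)]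
  show ?thesis
    unfolding jacobi_point_def
  proof (rule ec_add_rescaled[OF assms(1,2) _ _ refl refl refl chord(2,3)])
    have eq: "e + r^2 * ((1 + c1) / (1 - c1)) = e + r^2 * ((1 + c2) / (1 - c2)) \<longleftrightarrow> False"
      using chord(1) \<open>r \<noteq> 0\<close> by (simp del: times_divide_eq_right)
    show "\<not> (e + r^2 * ((1 + c1) / (1 - c1)) = e + r^2 * ((1 + c2) / (1 - c2)) \<and>
        4 * r^3 * (s1 * d1 / (1 - c1)^2) = - (4 * r^3 * (s2 * d2 / (1 - c2)^2)))"
      unfolding eq by simp
    have slope: "(4 * r^3 * Y2 - 4 * r^3 * Y1) / (e + r^2 * X2 - (e + r^2 * X1))
        = 4 * r * ((Y2 - Y1) / (X2 - X1))" for X1 X2 Y1 Y2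
    proof -
      have "(4 * r^3 * Y2 - 4 * r^3 * Y1) / (e + r^2 * X2 - (e + r^2 * X1))
          = (r^2 * (4 * r * (Y2 - Y1))) / (r^2 * (X2 - X1))"
        by (simp add: algebra_simps power3_eq_cube power2_eq_square)
      also have "\<dots> = 4 * r * (Y2 - Y1) / (X2 - X1)"
        using \<open>r \<noteq> 0\<close> by (intro mult_divide_mult_cancel_left) simp
      finally show ?thesis by simp
    qed
    show "(if e + r^2 * ((1 + c1) / (1 - c1)) = e + r^2 * ((1 + c2) / (1 - c2))
       then (12 * (e + r^2 * ((1 + c1) / (1 - c1)))^2 - g2) / (2 * (4 * r^3 * (s1 * d1 / (1 - c1)^2)))
       else (4 * r^3 * (s2 * d2 / (1 - c2)^2) - 4 * r^3 * (s1 * d1 / (1 - c1)^2)) /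
            (e + r^2 * ((1 + c2) / (1 - c2)) - (e + r^2 * ((1 + c1) / (1 - c1)))))
      = 4 * r * ((s2 * d2 / (1 - c2)^2 - s1 * d1 / (1 - c1)^2) /
         ((1 + c2) / (1 - c2) - (1 + c1) / (1 - c1)))"
      unfolding eq if_False by (rule slope)
  qed
qed

lemma jacobi_point_tangent:
  assumes "r \<noteq> 0" "3 * e = r^2 * (2 - 4 * k)"
    and "s^2 + c^2 = 1" "d^2 = 1 - k * s^2"
    and "s \<noteq> 0" "d \<noteq> 0" "1 - k * s^2 * s^2 \<noteq> 0"
    and "s3 = (s * c * d + s * c * d) / (1 - k * s^2 * s^2)"
    and "c3 = (c * c - s * s * d * d) / (1 - k * s^2 * s^2)"
    and "d3 = (d * d - k * s * s * c * c) / (1 - k * s^2 * s^2)"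
    and g2: "g2 = 4 * (3 * e^2 - r^4)"
  shows "ec_add g2 (jacobi_point e r s c d) (jacobi_point e r s c d) = jacobi_point e r s3 c3 d3"
proof -
  have c: "c \<noteq> 1" using jacobi_coordinates[OF assms(3,5)] by simp
  note tangent = jacobi_tangent[OF assms(3-10)]
  show ?thesis
    unfolding jacobi_point_def
  proof (rule ec_add_rescaled[OF assms(1,2) _ _ refl refl refl tangent(1,2)])
    define X Y where "X = (1 + c) / (1 - c)" and "Y = s * d / (1 - c)^2"
    \<comment> \<open>The tangent is not vertical, so the double is an affine point.\<close>
    have Y: "Y \<noteq> 0" using assms c by (simp add: Y_def)
    show "\<not> (e + r^2 * ((1 + c) / (1 - c)) = e + r^2 * ((1 + c) / (1 - c)) \<and>
        4 * r^3 * (s * d / (1 - c)^2) = - (4 * r^3 * (s * d / (1 - c)^2)))"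
      unfolding Y_def[symmetric] using Y \<open>r \<noteq> 0\<close> by simp
    have "12 * (e + r^2 * X)^2 - g2 = 4 * r^4 * (3 * X^2 + 2 * (2 - 4 * k) * X + 1)"
      using assms(2) g2 by algebra
    moreover have "4 * r^4 * Z / (2 * (4 * r^3 * Y)) = 4 * r * (Z / (8 * Y))" for Z
      using Y \<open>r \<noteq> 0\<close> by (simp add: field_simps power3_eq_cube power4_eq_xxxx)
    ultimately have "(12 * (e + r^2 * X)^2 - g2) / (2 * (4 * r^3 * Y))
        = 4 * r * ((3 * X^2 + 2 * (2 - 4 * k) * X + 1) / (8 * Y))"
      by (simp only:)
    then show "(if e + r^2 * ((1 + c) / (1 - c)) = e + r^2 * ((1 + c) / (1 - c))
       then (12 * (e + r^2 * ((1 + c) / (1 - c)))^2 - g2) / (2 * (4 * r^3 * (s * d / (1 - c)^2)))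
       else (4 * r^3 * (s * d / (1 - c)^2) - 4 * r^3 * (s * d / (1 - c)^2)) /
            (e + r^2 * ((1 + c) / (1 - c)) - (e + r^2 * ((1 + c) / (1 - c)))))
      = 4 * r * ((3 * ((1 + c) / (1 - c))^2 + 2 * (2 - 4 * k) * ((1 + c) / (1 - c)) + 1)
          / (8 * (s * d / (1 - c)^2)))"
      unfolding X_def Y_def by (simp only: if_True refl)
  qed
qed

section \<open>Multiples of a point whose parameter is an irrational multiple of the period\<close>

context elliptic_integral
begin

text \<open>A coincidence would make \<open>m - n\<close> or \<open>m + n\<close> times
  \<open>t\<close> an integer multiple of the period. The case \<open>n = 0\<close> keeps the
  positive multiples of \<open>t\<close> away from the pole.\<close>

lemma cn_multiples_distinct:
  assumes irr: "t / period \<notin> \<rat>" and "m \<noteq> n"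
  shows "cn (real m * t) \<noteq> cn (real n * t)"
proof
  assume "cn (real m * t) = cn (real n * t)"
  then obtain j :: int where
    "real m * t = real n * t + of_int j * period \<or> real m * t = - (real n * t) + of_int j * period"
    using cn_eq_imp by blast
  then have "(real m - real n) * t = of_int j * period \<or> (real m + real n) * t = of_int j * period"
    by (auto simp: algebra_simps)
  moreover have "real m - real n \<noteq> 0" "real m + real n \<noteq> 0"
    using \<open>m \<noteq> n\<close> by auto
  ultimately have "t / period = of_int j / (real m - real n) \<or> t / period = of_int j / (real m + real n)"
    using period_pos by (auto simp: field_simps)
  then have "t / period \<in> \<rat>" by auto
  with irr show False by contradiction
qed

text \<open>At a zero of \<open>sn\<close>, doubling the parameter would lead to the pole, where
  \<open>cn\<close> is 1.\<close>

lemma sn_multiples_nonzero: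
  assumes irr: "t / period \<notin> \<rat>" and "n > 0"
  shows "sn (real n * t) \<noteq> 0"
proof
  assume sn: "sn (real n * t) = 0"
  then have "cn (real n * t)^2 = 1"
    using sn_cn_squared[of "real n * t"] by simp
  then have "cn (real (2 * n) * t) = cn (real 0 * t)"
    using sn cn_add[of "real n * t" "real n * t"] by (simp add: power2_eq_square mult_ac)
  with cn_multiples_distinct[OF irr, of "2 * n" 0] \<open>n > 0\<close> show False by simp
qed

definition jacobi_curve :: "real \<Rightarrow> real \<Rightarrow> real \<Rightarrow> ec_point" where
  "jacobi_curve e r u = jacobi_point e r (sn u) (cn u) (dn u)"

text \<open>Adding the point once more is a tangent for \<open>n = 1\<close> and a chord between
  distinct abscissas afterwards. The induction starts at 1 because at parameter 0 the division by
  zero yields an affine value, not \<open>Infinity\<close>.\<close>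

lemma jacobi_curve_multiple:
  assumes irr: "t / period \<notin> \<rat>" and "n > 0"
    and "r \<noteq> 0" "3 * e = r^2 * (2 - 4 * k)" "g2 = 4 * (3 * e^2 - r^4)"
  shows "jacobi_curve e r t [^]\<^bsub>ec_group g2 g3\<^esub> n = jacobi_curve e r (real n * t)"
  using \<open>n > 0\<close>
proof (induction n rule: nat_induct_non_zero)
  case 1
  then show ?case by (simp add: nat_pow_def ec_group_def)
next
  case (Suc n)
  have pow: "P [^]\<^bsub>ec_group g2 g3\<^esub> Suc n = ec_add g2 (P [^]\<^bsub>ec_group g2 g3\<^esub> n) P" for P
    by (simp add: nat_pow_def ec_group_def)
  have nz: "sn (real n * t) \<noteq> 0" "sn t \<noteq> 0"
    using sn_multiples_nonzero[OF irr, of n] sn_multiples_nonzero[OF irr, of 1] Suc by auto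
  have sum: "real (Suc n) * t = real n * t + t" by (simp add: algebra_simps)
  have "ec_add g2 (jacobi_curve e r (real n * t)) (jacobi_curve e r t)
      = jacobi_curve e r (real n * t + t)"
  proof (cases "n = 1")
    case True
    show ?thesis
      unfolding jacobi_curve_def True
      using jacobi_point_tangent[OF assms(3,4) sn_cn_squared dn_squared _ _ _ sn_add cn_add dn_add assms(5), of t]
        nz dn_pos[of t] addition_denominator_pos[of t t] by simp
  next
    case False
    have "cn (real n * t) \<noteq> cn t"
      using cn_multiples_distinct[OF irr, of n 1] False by simp
    moreover have "cn (real n * t + t) \<noteq> 1"
      using cn_multiples_distinct[OF irr, of "Suc n" 0] unfolding sum by simp
    ultimately show ?thesis
      unfolding jacobi_curve_def
      using nz addition_denominator_pos[of "real n * t" t]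
      by (intro jacobi_point_chord[OF assms(3,4) sn_cn_squared sn_cn_squared dn_squared dn_squared
            sn_cn_squared _ _ _ _ _ sn_add cn_add dn_add]) auto
  qed
  then show ?case by (simp only: pow Suc.IH sum)
qed

lemma jacobi_curve_near_infinity:
  assumes r: "r > 0" and B: "B > 0"
  obtains b where "b > 0"
    and "\<And>u. 0 < u \<Longrightarrow> u < b \<Longrightarrow>
      x_coord (jacobi_curve e r u) > B^2 \<and> y_coord (jacobi_curve e r u) > B^3"
proof -
  \<comment> \<open>The first bound serves the abscissa \<open>e + r^2 * X\<close>; the second
    serves the ordinate \<open>4 * r^3 * Y\<close>, by way of \<open>2 * Y > X\<close>.\<close>
  define C where "C = max ((B^2 - e) / r^2) (B^3 / (2 * r^3))"
  obtain b where "b > 0" and b: "\<And>u. 0 < u \<Longrightarrow> u < b \<Longrightarrow>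
      sn u > 0 \<and> cn u < 1 \<and> dn u > 1/2 \<and> (1 + cn u) / (1 - cn u) > C"
    using eventually_near_pole[of C] unfolding eventually_at_right_field by blast
  show ?thesis
  proof (rule that[OF \<open>b > 0\<close>])
    fix u assume "0 < u" "u < b"
    note u = b[OF this]
    define X where "X = (1 + cn u) / (1 - cn u)"
    define Y where "Y = sn u * dn u / (1 - cn u)^2"
    have X: "X > (B^2 - e) / r^2" "X > B^3 / (2 * r^3)"
      using u by (auto simp: X_def C_def)
    have "X > 0"
      using X(2) B r by (smt (verit) divide_pos_pos zero_less_power)
    have "Y * sn u = dn u * X"
      using jacobi_coordinates(3,4)[OF sn_cn_squared, of u] u
      unfolding X_def Y_def by (simp add: power2_eq_square power3_eq_cube)
    moreover have "sn u \<le> 1"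
      by (simp add: sn_def)
    moreover have "Y \<ge> 0"
      using u by (simp add: Y_def)
    ultimately have "dn u * X \<le> Y"
      by (metis mult.right_neutral mult_left_mono)
    moreover have "1/2 * X < dn u * X"
      using u \<open>X > 0\<close> by (intro mult_strict_right_mono) auto
    ultimately have Y: "2 * Y > X" by simp
    have "r^2 * X > B^2 - e" "2 * r^3 * X > B^3"
      using X r by (simp_all add: field_simps)
    moreover have "4 * r^3 * Y > 2 * r^3 * X"
      using mult_strict_left_mono[OF Y, of "2 * r^3"] r by simp
    ultimately have "e + r^2 * X > B^2" "4 * r^3 * Y > B^3" by linarith+
    then show "x_coord (jacobi_curve e r u) > B^2 \<and> y_coord (jacobi_curve e r u) > B^3"
      by (simp add: jacobi_curve_def jacobi_point_def X_def[symmetric] Y_def[symmetric])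
  qed
qed

lemma jacobi_curve_add_periods:
  "jacobi_curve e r (u + of_int n * period) = jacobi_curve e r u"
  by (simp add: jacobi_curve_def)

end

section \<open>One-sided Diophantine approximation by Baire's theorem\<close>

lemma one_sided_liouville:
  fixes \<epsilon> :: "nat \<Rightarrow> real"
  assumes "\<And>n. \<epsilon> n > 0"
  obtains \<theta> where "\<theta> \<notin> \<rat>"
    and "\<And>N. \<exists>n>N. \<exists>p::int. of_int p < real n * \<theta> \<and> real n * \<theta> < of_int p + \<epsilon> n"
proof -
  define U where "U N = (\<Union>n\<in>{N<..}. \<Union>p::int. {of_int p / real n <..< (of_int p + \<epsilon> n) / real n})" for N
  have U: "open (U N)" "closure (U N) = UNIV" for N
  proof -
    show "open (U N)" unfolding U_def by (intro open_UN ballI open_greaterThanLessThan)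
    have "\<exists>y\<in>U N. dist y x < \<delta>" if "\<delta> > 0" for x \<delta>
    proof -
      obtain n0 :: nat where n0: "1 / \<delta> < real n0"
        using reals_Archimedean2 by blast
      define n where "n = max n0 (Suc N)"
      have n: "n > N" "n > 0" "1 / \<delta> < real n" using n0 by (auto simp: n_def)
      then have "1 < real n * \<delta>" using that by (simp add: field_simps)
      define p where "p = \<lfloor>real n * x\<rfloor>"
      \<comment> \<open>\<open>h < \<epsilon> n\<close> puts \<open>y\<close> into
        \<open>U N\<close>; \<open>h < 1\<close> keeps \<open>y\<close> within \<open>1 / n\<close>
        of \<open>x\<close>.\<close>
      define h where "h = min (\<epsilon> n) 1 / 2"
      have h: "0 < h" "h < \<epsilon> n" "h < 1" using assms[of n] by (auto simp: h_def)
      define y where "y = (of_int p + h) / real n"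
      have "y \<in> U N"
      proof -
        have "y \<in> {of_int p / real n <..< (of_int p + \<epsilon> n) / real n}"
          using n h by (simp add: y_def divide_strict_right_mono)
        then show ?thesis unfolding U_def using n by blast
      qed
      moreover have "real n * y = of_int p + h" using n by (simp add: y_def)
      then have "\<bar>real n * (y - x)\<bar> < 1"
        using h unfolding p_def by (simp add: right_diff_distrib) linarith
      then have "real n * \<bar>y - x\<bar> < real n * \<delta>"
        using \<open>1 < real n * \<delta>\<close> by (simp add: abs_mult)
      then have "dist y x < \<delta>" using n by (simp add: dist_real_def)
      ultimately show ?thesis by blast
    qed
    then show "closure (U N) = UNIV" by (auto simp: closure_approachable)
  qed
  \<comment> \<open>Complements of rational points are open and dense too; including them forces
    irrationality.\<close>
  define \<G> where "\<G> = range U \<union> (\<lambda>q. - {q}) ` \<rat>"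
  have "UNIV \<subseteq> closure (\<Inter>\<G>)"
  proof (rule Baire)
    show "countable \<G>"
      by (simp add: \<G>_def countable_rat)
    show "openin (top_of_set UNIV) T \<and> UNIV \<subseteq> closure T" if "T \<in> \<G>" for T
      using that U by (auto simp: \<G>_def closure_complement)
  qed auto
  then obtain \<theta> where \<theta>: "\<theta> \<in> \<Inter>\<G>"
    by (metis closure_empty equals0I subset_empty UNIV_not_empty)
  show ?thesis
  proof
    show "\<theta> \<notin> \<rat>" using \<theta> by (auto simp: \<G>_def)
    fix N
    have "\<theta> \<in> U N" using \<theta> by (auto simp: \<G>_def)
    then show "\<exists>n>N. \<exists>p::int. of_int p < real n * \<theta> \<and> real n * \<theta> < of_int p + \<epsilon> n"
      by (force simp: U_def field_simps)
  qed
qed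

section \<open>Reduction of the cubic to Jacobi form\<close>

lemma cubic_pos_of_large:
  fixes x g2 g3 :: real
  assumes "x \<ge> 1 + \<bar>g2\<bar> + \<bar>g3\<bar>"
  shows "4 * x^3 - g2 * x - g3 > 0"
proof -
  have "x \<ge> 1" using assms by linarith
  have "\<bar>g2\<bar> * x + \<bar>g3\<bar> * 1 \<le> \<bar>g2\<bar> * x + \<bar>g3\<bar> * x"
    using \<open>x \<ge> 1\<close> by (intro add_left_mono mult_left_mono) auto
  also have "\<dots> = (\<bar>g2\<bar> + \<bar>g3\<bar>) * x" by (simp add: algebra_simps)
  also have "\<dots> \<le> x * x"
    using assms \<open>x \<ge> 1\<close> by (intro mult_right_mono) auto
  also have "\<dots> \<le> x * x * x"
    using mult_left_mono[OF \<open>x \<ge> 1\<close>, of "x * x"] by simp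
  finally have "\<bar>g2\<bar> * x + \<bar>g3\<bar> \<le> x^3" by (simp add: power3_eq_cube)
  moreover have "g2 * x \<le> \<bar>g2\<bar> * x" using \<open>x \<ge> 1\<close> by (intro mult_right_mono) auto
  moreover have "x^3 > 0" using \<open>x \<ge> 1\<close> by simp
  ultimately show ?thesis by linarith
qed

lemma elliptic_curve_jacobi_form:
  assumes "elliptic_curve g2 g3"
  obtains e r k :: real where "r > 0" "k < 1" "3 * e = r^2 * (2 - 4 * k)"
    "g2 = 4 * (3 * e^2 - r^4)" "g3 = 4 * e^3 - g2 * e"
proof -
  define f where "f x = 4 * x^3 - g2 * x - g3" for x
  define L where "L = 1 + \<bar>g2\<bar> + \<bar>g3\<bar>"
  have cont: "isCont f x" for x unfolding f_def by (intro continuous_intros)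
  have large: "f x > 0" if "x \<ge> L" for x
    using cubic_pos_of_large that by (simp add: f_def L_def)
  \<comment> \<open>\<open>- f (- L)\<close> is the value at \<open>L\<close> of the cubic with
    \<open>- g3\<close> in place of \<open>g3\<close>.\<close>
  have "f (- L) < 0"
    using cubic_pos_of_large[of g2 "- g3" L] by (simp add: f_def L_def[symmetric])
  then have "\<exists>x\<ge>-L. x \<le> L \<and> f x = 0"
    using large[of L] cont by (intro IVT) (auto simp: L_def)
  then have ne: "{x. f x = 0} \<noteq> {}" by auto
  have fin: "finite {x. f x = 0}"
    using poly_roots_finite[of "[:- g3, - g2, 0, 4:]"]
    by (simp add: f_def algebra_simps power3_eq_cube)
  \<comment> \<open>Beyond the largest root the cubic is positive, hence so is its quadratic
    cofactor \<open>q\<close>; this will give \<open>k < 1\<close>.\<close>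
  define e where "e = Max {x. f x = 0}"
  have fe: "f e = 0" using Max_in[OF fin ne] by (simp add: e_def)
  have pos: "f x > 0" if "x > e" for x
  proof (rule ccontr)
    assume "\<not> f x > 0"
    moreover from this have "x < L" using large[of x] by force
    ultimately obtain y where "x \<le> y" "f y = 0"
      using IVT[of f x 0 L] large[of L] cont by auto
    with Max_ge[OF fin, of y] that show False by (auto simp: e_def)
  qed
  define c where "c = 3 * e^2 - g2 / 4"
  have g3: "g3 = 4 * e^3 - g2 * e" using fe by (simp add: f_def)
  have q: "X^2 + 3 * e * X + c > 0" if "X > 0" for X
  proof -
    have "4 * X * (X^2 + 3 * e * X + c) = f (e + X)"
      unfolding f_def g3 c_def by (simp add: algebra_simps power3_eq_cube power2_eq_square)
    with pos[of "e + X"] that show ?thesis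
      by (metis less_add_same_cancel1 mult_pos_pos zero_less_mult_pos zero_less_numeral)
  qed
  have "((\<lambda>X. X^2 + 3 * e * X + c) \<longlongrightarrow> 0^2 + 3 * e * 0 + c) (at_right 0)"
    by (intro tendsto_intros)
  then have "0^2 + 3 * e * 0 + c \<ge> 0"
    by (rule tendsto_lowerbound)
       (auto intro: eventually_mono[OF eventually_at_right_less] less_imp_le q)
  \<comment> \<open>For \<open>c = 0\<close> the root \<open>e\<close> would be a double
    root.\<close>
  moreover have "c \<noteq> 0"
  proof
    assume "c = 0"
    then have "g2 = 12 * e^2" by (simp add: c_def)
    then have "g2^3 - 27 * g3^2 = 0" using g3 by algebra
    with assms show False by (simp add: elliptic_curve_def)
  qed
  ultimately have c: "c > 0" by simp
  \<comment> \<open>\<open>h\<close> plays the role of \<open>r^2\<close>, since \<open>r^4\<close>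
    must be \<open>c\<close>; then \<open>3 * e = h * (2 - 4 * k)\<close> determines
    \<open>k\<close>.\<close>
  define h where "h = sqrt c"
  have h: "h > 0" "h^2 = c" using c by (simp_all add: h_def)
  show ?thesis
  proof
    show "sqrt h > 0" using h by simp
    \<comment> \<open>This is the cofactor at \<open>h\<close>; its positivity amounts to
      \<open>k < 1\<close>.\<close>
    have "h * (2 * h + 3 * e) > 0"
      using q[OF h(1)] by (simp add: h(2)[symmetric] power2_eq_square algebra_simps)
    then have "2 * h + 3 * e > 0" using h(1) zero_less_mult_pos by blast
    then show "(2 - 3 * e / h) / 4 < 1" using h(1) by (simp add: field_simps)
    show "3 * e = (sqrt h)^2 * (2 - 4 * ((2 - 3 * e / h) / 4))" using h(1) by (simp add: field_simps)
    have "(sqrt h)^4 = ((sqrt h)^2)^2" by (simp only: power_mult[symmetric]) simp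
    then have "(sqrt h)^4 = c" using h by simp
    then show "g2 = 4 * (3 * e^2 - (sqrt h)^4)" by (simp add: c_def)
  qed (fact g3)
qed

section \<open>Choice of the point and its large multiples\<close>

theorem theorem3:
  fixes g2 g3 :: real and \<psi> :: "nat \<Rightarrow> real"
  assumes "elliptic_curve g2 g3"
    and "\<And>n. \<psi> n > 0"
  shows "\<exists>P \<in> carrier (ec_group g2 g3).
    infinite {n :: nat. n > 0 \<and>
      P [^]\<^bsub>ec_group g2 g3\<^esub> n \<noteq> Infinity \<and>
      x_coord (P [^]\<^bsub>ec_group g2 g3\<^esub> n) > \<psi> n ^ 2 \<and>
      y_coord (P [^]\<^bsub>ec_group g2 g3\<^esub> n) > \<psi> n ^ 3}"
proof -
  obtain e r k where "r > 0" "k < 1" and curve: "3 * e = r^2 * (2 - 4 * k)"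
      "g2 = 4 * (3 * e^2 - r^4)" "g3 = 4 * e^3 - g2 * e"
    using elliptic_curve_jacobi_form[OF assms(1)] .
  obtain F where "elliptic_integral k F"
    using elliptic_integral_exists[OF \<open>k < 1\<close>] .
  then interpret elliptic_integral k F .
  let ?G = "ec_group g2 g3"
  have "\<exists>b>0. \<forall>u. 0 < u \<longrightarrow> u < b \<longrightarrow>
      x_coord (jacobi_curve e r u) > \<psi> n^2 \<and> y_coord (jacobi_curve e r u) > \<psi> n^3" for n
    using jacobi_curve_near_infinity[OF \<open>r > 0\<close> assms(2)[of n]] by metis
  then obtain b where b_pos: "\<And>n. b n > 0" and b: "\<And>n u. 0 < u \<Longrightarrow> u < b n \<Longrightarrow>
      x_coord (jacobi_curve e r u) > \<psi> n^2 \<and> y_coord (jacobi_curve e r u) > \<psi> n^3"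
    by metis
  obtain \<theta> where irr: "\<theta> \<notin> \<rat>" and approx:
    "\<And>N. \<exists>n>N. \<exists>p::int. of_int p < real n * \<theta> \<and> real n * \<theta> < of_int p + b n / period"
    using one_sided_liouville[of "\<lambda>n. b n / period"] b_pos period_pos by auto
  define t where "t = \<theta> * period"
  define P where "P = jacobi_curve e r t"
  have t: "t / period \<notin> \<rat>" using irr period_pos by (simp add: t_def)
  have pow: "P [^]\<^bsub>?G\<^esub> n = jacobi_curve e r (real n * t)" if "n > 0" for n :: nat
    unfolding P_def using jacobi_curve_multiple[OF t that _ curve(1,2)] \<open>r > 0\<close> by simp
  show ?thesis
  proof (intro bexI[of _ P])
    have "cn t \<noteq> 1"
      using cn_multiples_distinct[OF t, of 1 0] by simp
    then show "P \<in> carrier ?G"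
      unfolding P_def jacobi_curve_def ec_group_def
      using jacobi_point_in_ec_points[OF sn_cn_squared dn_squared _ curve] by simp
    show "infinite {n :: nat. n > 0 \<and> P [^]\<^bsub>?G\<^esub> n \<noteq> Infinity \<and>
        x_coord (P [^]\<^bsub>?G\<^esub> n) > \<psi> n ^ 2 \<and> y_coord (P [^]\<^bsub>?G\<^esub> n) > \<psi> n ^ 3}"
      unfolding infinite_nat_iff_unbounded
    proof
      fix N
      obtain n and p :: int where n: "n > N"
        and p: "of_int p < real n * \<theta>" "real n * \<theta> < of_int p + b n / period"
        using approx by blast
      \<comment> \<open>\<open>u\<close> is \<open>n * t\<close> reduced by \<open>p\<close>
        periods. The tolerance \<open>b n / period\<close> for \<open>\<theta>\<close> was chosen to
        make \<open>u < b n\<close>.\<close>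
      define u where "u = (real n * \<theta> - of_int p) * period"
      have "0 < u" "u < b n"
        using p period_pos by (simp_all add: u_def field_simps)
      moreover have "P [^]\<^bsub>?G\<^esub> n = jacobi_curve e r u"
        using pow[of n] n jacobi_curve_add_periods[of e r u p]
        by (simp add: u_def t_def algebra_simps)
      ultimately show "\<exists>n>N. n \<in> {n :: nat. n > 0 \<and> P [^]\<^bsub>?G\<^esub> n \<noteq> Infinity \<and>
          x_coord (P [^]\<^bsub>?G\<^esub> n) > \<psi> n ^ 2 \<and> y_coord (P [^]\<^bsub>?G\<^esub> n) > \<psi> n ^ 3}"
        using b[of u n] n by (auto simp: jacobi_curve_def jacobi_point_def intro!: exI[of _ n])
    qed
  qed
qed

end
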